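(* Let $p\ge 7$ be a prime and let $V$ be the curve defined over $\mathbb{F}_p$ in $\mathrm{PG}(p-2,\overline{\mathbb{F}}_p)$ by the equations $X_1^k+X_2^k+\cdots+X_{p-1}^k=0$ for $1\le k\le p-3$. Let $d$ be the smallest positive integer such that $(p-2)\mid(p^d-1)$. Then $\Omega_\theta\subset V(\mathbb{F}_{p^d})$ and $\Omega_\varepsilon\subset V(\mathbb{F}_{p^d})$, but, for every positive integer $i<d$, $\Omega_\theta\nsubseteq V(\mathbb{F}_{p^i})$ and $\Omega_\varepsilon\nsubseteq V(\mathbb{F}_{p^i})$.
   Context: $G\cong\mathrm{Sym}_{p-1}$ acts on $V$ by permuting the homogeneous coordinates $X_1,\ldots,X_{p-1}$. $\Omega_\varepsilon$ is the $G$-orbit of the point $(\varepsilon:\varepsilon^2:\cdots:\varepsilon^{p-2}=1:0)\in V$, where $\varepsilon\in\overline{\mathbb{F}}_p$ is a primitive $(p-2)$-th root of unity. $\Omega_\theta$ is the $G$-orbit consisting of all points of $V$ fixed by some transposition of $G$, i.e. all points of $V$ having two equal coordinates in distinct positions (these points form a single $G$-orbit). $V(\mathbb{F}_{p^i})$ denotes the set of all points of $V$ lying in $\mathrm{PG}(p-2,\mathbb{F}_{p^i})$. *)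

theory Defs
  imports
    "HOL-Algebra.Algebraic_Closure_Type"
    "HOL-Algebra.Group_Action"
    "HOL-Algebra.Sym_Groups"
    "HOL-Combinatorics.Transposition"
    "Berlekamp_Zassenhaus.Finite_Field"
begin

section \<open>Finite fields inside the algebraic closure of a prime field\<close>

text \<open>The algebraic closure of the field with \<open>p = CARD('p)\<close> elements.\<close>

type_synonym 'p fp_bar = "'p mod_ring alg_closure"

text \<open>
  The unique subfield with \<open>q\<close> elements. Existence and uniqueness, for \<open>q\<close> a positive power of
  the characteristic of an algebraically closed field, are proved in \<open>GF_eq\<close> below.
\<close>

definition GF :: "nat \<Rightarrow> 'a::field set" where
  "GF q = (THE F. subfield F (ring_of_type_algebra :: 'a ring) \<and> card F = q)"

definition primitive_root_of_unity :: "nat \<Rightarrow> 'a::field \<Rightarrow> bool" where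
  "primitive_root_of_unity n \<epsilon> \<longleftrightarrow> \<epsilon> ^ n = 1 \<and> (\<forall>j. 0 < j \<and> j < n \<longrightarrow> \<epsilon> ^ j \<noteq> 1)"


section \<open>Projective space\<close>

text \<open>
  A coordinate vector \<open>(X\<^sub>1, \<dots>, X\<^sub>n)\<close> is a function on \<open>nat\<close> vanishing outside \<open>{1..n}\<close>;
  a projective point is the set of all nonzero scalar multiples of a nonzero vector, the
  scalars ranging over the whole ambient field.
\<close>

type_synonym 'a point = "(nat \<Rightarrow> 'a) set"

definition proj_point :: "(nat \<Rightarrow> 'a::field) \<Rightarrow> 'a point" where
  "proj_point x = {(\<lambda>j. c * x j) | c. c \<noteq> 0}"

text \<open>
  \<open>PG m F\<close> is the set of the points of \<open>m\<close>-dimensional projective space (\<open>m + 1\<close> homogeneous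
  coordinates) over the ambient field that have homogeneous coordinates in the subfield \<open>F\<close>.
\<close>

definition PG :: "nat \<Rightarrow> 'a::field set \<Rightarrow> 'a point set" where
  "PG m F = {proj_point x | x.
     (\<forall>j\<in>{1..m+1}. x j \<in> F) \<and> (\<forall>j. j \<notin> {1..m+1} \<longrightarrow> x j = 0) \<and> (\<exists>j. x j \<noteq> 0)}"

definition permute_coords :: "(nat \<Rightarrow> nat) \<Rightarrow> 'a point \<Rightarrow> 'a point" where
  "permute_coords \<pi> P = (\<lambda>x. x \<circ> Hilbert_Choice.inv \<pi>) ` P"


section \<open>The curve and the two orbits\<close>

definition curve_V :: "nat \<Rightarrow> 'a::field point set" where
  "curve_V p = {P \<in> PG (p - 2) UNIV. \<forall>x\<in>P. \<forall>k\<in>{1..p-3}. (\<Sum>j=1..p-1. x j ^ k) = 0}"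

definition V_points :: "nat \<Rightarrow> nat \<Rightarrow> 'a::field point set" where
  "V_points p i = curve_V p \<inter> PG (p - 2) (GF (p ^ i))"

text \<open>The last nonzero coordinate is \<open>\<epsilon> ^ (p - 2) = 1\<close>; the coordinate at \<open>p - 1\<close> is \<open>0\<close>.\<close>

definition eps_point :: "nat \<Rightarrow> 'a::field \<Rightarrow> 'a point" where
  "eps_point p \<epsilon> = proj_point (\<lambda>j. if j \<in> {1..p-2} then \<epsilon> ^ j else 0)"

definition Omega_eps :: "nat \<Rightarrow> 'a::field \<Rightarrow> 'a point set" where
  "Omega_eps p \<epsilon> = orbit (sym_group (p - 1)) permute_coords (eps_point p \<epsilon>)"

definition Omega_theta :: "nat \<Rightarrow> 'a::field point set" where
  "Omega_theta p = {P \<in> curve_V p. \<exists>a\<in>{1..p-1}. \<exists>b\<in>{1..p-1}.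
     a \<noteq> b \<and> permute_coords (Transposition.transpose a b) P = P}"


section \<open>Adequacy of the definitions\<close>

lemma card_roots_separable:
  fixes f :: "'a::alg_closed_field poly"
  assumes "rsquarefree f"
  shows "card {x. poly f x = 0} = degree f"
proof -
  have f: "f \<noteq> 0" using assms by (simp add: rsquarefree_def)
  obtain A where A: "size A = degree f" "f = smult (lead_coeff f) (\<Prod>x\<in>#A. [:-x, 1:])"
    using alg_closed_imp_factorization[OF f] by blast
  have ord: "order x f = count A x" for x
  proof -
    have nz: "(\<Prod>x\<in>#B. [:-x, 1:]) \<noteq> (0 :: 'a poly)" for B :: "'a multiset"
      by (auto simp: prod_mset_zero_iff)
    have "order x (\<Prod>x\<in>#B. [:-x, 1:]) = count B x" for B :: "'a multiset"
    proof (induction B)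
      case empty
      show ?case by (simp add: order_0I)
    next
      case (add b B)
      have *: "order x [:-b, 1:] = (if x = b then 1 else 0)"
        using order_power_n_n[of b 1] by (auto intro: order_0I)
      have "[:-b, 1:] * (\<Prod>x\<in>#B. [:-x, 1:]) \<noteq> 0"
        using nz[of "add_mset b B"] by simp
      from order_mult[OF this, of x]
      have "order x (\<Prod>x\<in>#add_mset b B. [:-x, 1:]) = (if x = b then 1 else 0) + count B x"
        unfolding * add.IH by (simp only: image_mset_add_mset prod_mset.add_mset)
      then show ?case by (cases "x = b") auto
    qed
    then show ?thesis
      using f by (subst A(2)) (simp only: order_smult leading_coeff_neq_0 not_False_eq_True)
  qed
  have le: "count A x \<le> 1" for x
    using assms ord[of x] unfolding rsquarefree_def by (auto dest: spec[of _ x])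
  have roots: "{x. poly f x = 0} = set_mset A"
  proof (rule Set.set_eqI)
    fix x
    have "poly f x = 0 \<longleftrightarrow> count A x \<noteq> 0" using order_root[of f x] f unfolding ord by blast
    then show "x \<in> {x. poly f x = 0} \<longleftrightarrow> x \<in># A" by simp
  qed
  have "size A = (\<Sum>x\<in>set_mset A. count A x)"
    by (simp add: size_multiset_overloaded_eq)
  also have "\<dots> = (\<Sum>x\<in>set_mset A. 1)"
  proof (rule sum.cong)
    fix x assume "x \<in> set_mset A"
    then show "count A x = 1" using le[of x] count_greater_zero_iff[of A x] by linarith
  qed simp
  finally show ?thesis using roots A(1) by simp
qed

lemma rsquarefree_if_pderiv:
  fixes f :: "'a::field poly"
  assumes "f \<noteq> 0" and "\<And>a. poly (pderiv f) a \<noteq> 0"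
  shows "rsquarefree f"
proof -
  have "order a f \<le> 1" for a
  proof (rule ccontr)
    assume "\<not> order a f \<le> 1"
    then have "2 \<le> order a f" by simp
    then have "[:-a, 1:] ^ 2 dvd f" using order_divides by blast
    then obtain g where "f = [:-a, 1:] ^ 2 * g" by (elim dvdE)
    then have f: "f = [:-a, 1:] * ([:-a, 1:] * g)" by (simp only: power2_eq_square mult.assoc)
    have "poly (pderiv f) a = 0"
      unfolding f by (simp only: pderiv_mult poly_add poly_mult) simp
    then show False using assms(2) by blast
  qed
  then show ?thesis using assms(1) unfolding rsquarefree_def by (simp add: le_Suc_eq)
qed

lemma ring_of_type_algebra_simps:
  fixes R :: "'a::field ring"
  defines "R \<equiv> ring_of_type_algebra"
  shows "carrier R = UNIV" "x \<otimes>\<^bsub>R\<^esub> y = x * y" "x \<oplus>\<^bsub>R\<^esub> y = x + y"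
    "\<one>\<^bsub>R\<^esub> = 1" "\<zero>\<^bsub>R\<^esub> = 0" "\<ominus>\<^bsub>R\<^esub> x = - x" "x \<noteq> 0 \<Longrightarrow> inv\<^bsub>R\<^esub> x = inverse x"
proof -
  interpret field R unfolding R_def by rule
  show 1: "carrier R = UNIV" "x \<otimes>\<^bsub>R\<^esub> y = x * y" "x \<oplus>\<^bsub>R\<^esub> y = x + y"
    "\<one>\<^bsub>R\<^esub> = 1" "\<zero>\<^bsub>R\<^esub> = 0" for x y
    by (simp_all add: R_def ring_of_type_algebra_def)
  show "\<ominus>\<^bsub>R\<^esub> x = - x"
    using minus_equality[of "-x" x] by (simp add: 1)
  show "inv\<^bsub>R\<^esub> x = inverse x" if "x \<noteq> 0"
    using inv_unique'[of x "inverse x"] that by (simp add: 1)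
qed

text \<open>The subfield with \<open>p ^ i\<close> elements exists, is unique, and is the set of fixed points of the
  \<open>i\<close>-th power of the Frobenius map.\<close>

lemma subfield_card_iff:
  fixes F :: "'a::alg_closed_field set"
  assumes p: "prime p" "CHAR('a) = p" and i: "i > 0"
  shows "subfield F (ring_of_type_algebra :: 'a ring) \<and> card F = p ^ i \<longleftrightarrow> F = {x. x ^ (p ^ i) = x}"
proof -
  define R where "R = (ring_of_type_algebra :: 'a ring)"
  note [simp] = ring_of_type_algebra_simps[where 'a = 'a, folded R_def]
  interpret K: field R unfolding R_def by rule
  define q where "q = p ^ i"
  have q: "q > 1" unfolding q_def by (rule one_less_power[OF prime_gt_1_nat[OF p(1)] i])
  define S where "S = {x :: 'a. x ^ q = x}"
  have q0: "(of_nat q :: 'a) = 0"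
    using i p(2) unfolding q_def of_nat_power by (metis of_nat_CHAR power_0_left not_gr0)
  define f :: "'a poly" where "f = monom 1 q + [:0, -1:]"
  have deg: "degree f = q"
    using q degree_add_eq_left[of "[:0, -1:]" "monom (1 :: 'a) q"]
    unfolding f_def by (simp add: degree_monom_eq)
  have "pderiv f = [:-1:]"
    unfolding f_def by (simp add: pderiv_add pderiv_monom q0 pderiv_pCons)
  then have "rsquarefree f" by (intro rsquarefree_if_pderiv) (use deg q in auto)
  then have "card {x. poly f x = 0} = q" using card_roots_separable deg by metis
  moreover have "{x. poly f x = 0} = S" by (auto simp: f_def S_def poly_monom)
  ultimately have cardS: "card S = q" by simp
  have finS: "finite S" using cardS q by (metis card.infinite not_less_zero)
  have addp: "(x + y) ^ q = x ^ q + y ^ q" for x y :: 'a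
    unfolding q_def by (rule freshmans_dream'[where n = i]) (use p in simp_all)
  have zerop: "(0 :: 'a) ^ q = 0" using q by simp
  have negp: "(- x) ^ q = - (x ^ q)" for x :: 'a
    using addp[of x "-x"] unfolding eq_neg_iff_add_eq_0 by (simp add: zerop add.commute)
  have sub: "subfield S R"
  proof (rule K.subfieldI'[OF K.subringI])
  qed (use q in \<open>auto simp: S_def addp negp power_mult_distrib power_inverse\<close>)
  have incl: "F \<subseteq> S" if F: "subfield F R" "card F = q" for F
  proof
    fix x assume x: "x \<in> F"
    show "x \<in> S"
    proof (cases "x = 0")
      case True then show ?thesis using q by (simp add: S_def)
    next
      case False
      define G where "G = F - {0}"
      have finF: "finite F" using F(2) q by (metis card.infinite not_less_zero)
      have clos: "y * z \<in> F" if "y \<in> F" "z \<in> F" for y z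
        using subringE(6)[OF subfieldE(1)[OF F(1)], of y z] that by simp
      have inj: "inj_on ((*) x) G" using False by (auto simp: inj_on_def)
      have "(*) x ` G = G"
        by (rule endo_inj_surj[OF _ _ inj]) (use finF clos x False in \<open>auto simp: G_def\<close>)
      then have "\<Prod>G = (\<Prod>y\<in>G. x * y)"
        using prod.reindex[OF inj, of id] by simp
      also have "\<dots> = x ^ card G * \<Prod>G" by (simp add: prod.distrib)
      finally have "x ^ card G = 1"
        using finF by (auto simp: G_def)
      moreover have "0 \<in> F" using subringE(2)[OF subfieldE(1)[OF F(1)]] by simp
      then have "card G = q - 1" using finF F(2) by (simp add: G_def)
      ultimately have "x ^ (Suc (q - 1)) = x" by simp
      then show ?thesis using q by (simp add: S_def)
    qed
  qed
  show ?thesis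
    unfolding R_def[symmetric] q_def[symmetric] S_def[symmetric]
  proof
    assume "subfield F R \<and> card F = q"
    then show "F = S" using incl[of F] card_subset_eq[OF finS] cardS by simp
  qed (use sub cardS in simp)
qed

lemma GF_eq:
  assumes "prime p" "CHAR('a::alg_closed_field) = p" "i > 0"
  shows "GF (p ^ i) = {x :: 'a. x ^ (p ^ i) = x}"
    and "subfield (GF (p ^ i)) (ring_of_type_algebra :: 'a ring)"
    and "card (GF (p ^ i) :: 'a set) = p ^ i"
proof -
  show eq: "GF (p ^ i) = {x :: 'a. x ^ (p ^ i) = x}"
    unfolding GF_def subfield_card_iff[OF assms] by simp
  show "subfield (GF (p ^ i)) (ring_of_type_algebra :: 'a ring)" "card (GF (p ^ i) :: 'a set) = p ^ i"
    using subfield_card_iff[OF assms, of "GF (p ^ i)"] eq by simp_all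
qed

text \<open>A point of the curve fixed by a transposition has two equal coordinates, and conversely.\<close>

lemma Omega_theta_iff:
  fixes P :: "'a::field point"
  assumes p: "p \<ge> 5" and two: "(2 :: 'a) \<noteq> 0"
  shows "P \<in> Omega_theta p \<longleftrightarrow>
    P \<in> curve_V p \<and> (\<exists>a\<in>{1..p-1}. \<exists>b\<in>{1..p-1}. a \<noteq> b \<and> (\<forall>x\<in>P. x a = x b))"
proof -
  have "permute_coords (Transposition.transpose a b) P = P \<longleftrightarrow> (\<forall>x\<in>P. x a = x b)"
    if P: "P \<in> curve_V p" and ab: "a \<in> {1..p-1}" "b \<in> {1..p-1}" "a \<noteq> b" for a b
  proof -
    let ?t = "Transposition.transpose a b"
    have act: "permute_coords ?t P = (\<lambda>x. x \<circ> ?t) ` P" by (simp add: permute_coords_def)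
    have fixd: "x \<circ> ?t = x" if "x a = x b" for x :: "nat \<Rightarrow> 'a"
      using that by (auto simp: fun_eq_iff Transposition.transpose_def)
    have "x a = x b" if eq: "permute_coords ?t P = P" and x: "x \<in> P" for x
    proof (rule ccontr)
      assume ne: "x a \<noteq> x b"
      obtain y where y: "P = proj_point y" "\<forall>j. j \<notin> {1..p-2+1} \<longrightarrow> y j = 0"
        using P by (auto simp: curve_V_def PG_def)
      obtain e where e: "x = (\<lambda>j. e * y j)" "e \<noteq> 0"
        using x y by (auto simp: proj_point_def)
      have "x \<circ> ?t \<in> P" using eq x act by blast
      then obtain d where d: "x \<circ> ?t = (\<lambda>j. d * y j)" "d \<noteq> 0"
        using y by (auto simp: proj_point_def)
      define c where "c = d / e"
      have c: "x (?t j) = c * x j" for j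
        using fun_cong[OF d(1), of j] e by (simp add: c_def)
      have xa: "x b = c * x a" "x a = c * x b" using c[of a] c[of b] by simp_all
      have c1: "c \<noteq> 1" using xa ne by auto
      have other: "x j = 0" if "j \<noteq> a" "j \<noteq> b" for j
        using c[of j] that c1 by simp
      have "x a \<noteq> 0" using xa ne by auto
      moreover have "(c * c) * x a = x a" using xa by (simp add: mult.assoc)
      ultimately have cc: "c * c = 1" by simp
      have "(\<Sum>j=1..p-1. x j ^ 2) = 0"
        using P x p by (auto simp: curve_V_def)
      moreover have "(\<Sum>j=1..p-1. x j ^ 2) = (\<Sum>j\<in>{a, b}. x j ^ 2)"
        by (rule sum.mono_neutral_right) (use ab other in auto)
      moreover have "(\<Sum>j\<in>{a, b}. x j ^ 2) = 2 * x a ^ 2"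
      proof -
        have "x b ^ 2 = (c * c) * x a ^ 2" using xa(1) by (simp add: power2_eq_square)
        then show ?thesis using ab cc by simp
      qed
      ultimately show False using two \<open>x a \<noteq> 0\<close> by simp
    qed
    then show ?thesis using act fixd by force
  qed
  then show ?thesis unfolding Omega_theta_def by blast
qed

end

theory Submission
  imports Defs
begin

text \<open>
  Over a field of characteristic \<open>p\<close>, the vanishing of the power sums of degrees \<open>1, \<dots>, p - 3\<close>
  of \<open>p - 1\<close> elements means, by Newton's argument, that these elements are the roots of a trinomial
  \<open>T\<^bsup>p-1\<^esup> + a T + b\<close>. If two of them are equal, they are nonzero, and after scaling this common
  value to \<open>1\<close> the trinomial becomes \<open>T\<^bsup>p-1\<^esup> + T - 2\<close>, which satisfies
  \<open>T (T\<^bsup>p-1\<^esup> + T - 2) = (T - 1)\<^sup>2 ((T - 1)\<^bsup>p-2\<^esup> + 1)\<close>. Hence \<open>\<Omega>\<^sub>\<theta>\<close> is the orbit of the point with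
  coordinates \<open>1, 1\<close> and \<open>1 - \<epsilon>\<^sup>j\<close> for \<open>1 \<le> j \<le> p - 3\<close>. For both orbits the coordinates, normalised
  to contain a \<open>1\<close>, generate \<open>\<F>\<^sub>p(\<epsilon>)\<close>, and \<open>\<epsilon>\<close> lies in the field with \<open>p\<^sup>i\<close> elements iff \<open>p - 2\<close>
  divides \<open>p\<^sup>i - 1\<close>.
\<close>

section \<open>Primitive roots of unity\<close>

lemma primitive_root_nonzero:
  fixes \<epsilon> :: "'a::field"
  assumes "primitive_root_of_unity n \<epsilon>" "n > 0"
  shows "\<epsilon> \<noteq> 0"
  using assms unfolding primitive_root_of_unity_def by (metis power_0_left not_gr0 zero_neq_one)

lemma primitive_root_power_eq_1_iff:
  fixes \<epsilon> :: "'a::field"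
  assumes "primitive_root_of_unity n \<epsilon>" "n > 0"
  shows "\<epsilon> ^ k = 1 \<longleftrightarrow> n dvd k"
proof -
  have "\<epsilon> ^ k = \<epsilon> ^ (n * (k div n) + k mod n)" by simp
  also have "\<dots> = \<epsilon> ^ (k mod n)"
    using assms(1) by (simp only: power_add power_mult primitive_root_of_unity_def) simp
  finally have "\<epsilon> ^ k = 1 \<longleftrightarrow> \<epsilon> ^ (k mod n) = 1" by simp
  also have "\<dots> \<longleftrightarrow> k mod n = 0"
    using assms mod_less_divisor[of n k] unfolding primitive_root_of_unity_def by (metis gr0I power_0)
  finally show ?thesis by (simp add: dvd_eq_mod_eq_0)
qed

text \<open>If \<open>n\<close> does not divide \<open>m\<close>, then \<open>\<epsilon> ^ m\<close>
  is a root of \<open>T ^ n - 1\<close> other than 1, so the geometric sum vanishes; otherwise every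
  summand is 1.\<close>

lemma primitive_root_sum_powers:
  fixes \<epsilon> :: "'a::field"
  assumes "primitive_root_of_unity n \<epsilon>" "n > 0"
  shows "(\<Sum>j<n. (\<epsilon> ^ j) ^ m) = (if n dvd m then of_nat n else 0)"
proof (cases "n dvd m")
  case True
  then have "\<epsilon> ^ m = 1" using primitive_root_power_eq_1_iff[OF assms] by blast
  then have "(\<epsilon> ^ j) ^ m = 1" for j
    by (metis mult.commute power_mult power_one)
  then show ?thesis using True by simp
next
  case False
  then have ne: "\<epsilon> ^ m \<noteq> 1" using primitive_root_power_eq_1_iff[OF assms] by blast
  have "(\<epsilon> ^ m) ^ n = 1"
    using assms(1) unfolding primitive_root_of_unity_def by (metis mult.commute power_mult power_one)
  then have "(\<epsilon> ^ m - 1) * (\<Sum>j<n. (\<epsilon> ^ m) ^ j) = 0"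
    using power_diff_1_eq[of "\<epsilon> ^ m" n] by simp
  then have "(\<Sum>j<n. (\<epsilon> ^ m) ^ j) = 0" using ne by simp
  then show ?thesis using False by (simp add: power_mult[symmetric] mult.commute)
qed

text \<open>The end terms agree because \<open>\<epsilon> ^ n = \<epsilon> ^ 0\<close>. This passes
  from the index range in \<open>eps_point\<close> to the one in
  \<open>primitive_root_sum_powers\<close>.\<close>

lemma sum_primitive_root_shift:
  fixes \<epsilon> :: "'a::field" and f :: "'a \<Rightarrow> 'b::comm_monoid_add"
  assumes "primitive_root_of_unity n \<epsilon>" "n > 0"
  shows "(\<Sum>j=1..n. f (\<epsilon> ^ j)) = (\<Sum>j<n. f (\<epsilon> ^ j))"
proof -
  obtain m where m: "n = Suc m" using assms(2) gr0_implies_Suc by blast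
  have "\<epsilon> ^ Suc m = \<epsilon> ^ 0"
    using assms(1) m by (simp only: primitive_root_of_unity_def power_0)
  then have "f (\<epsilon> ^ Suc m) = f (\<epsilon> ^ 0)" by (rule arg_cong)
  moreover have "(\<Sum>j=1..Suc m. f (\<epsilon> ^ j)) = (\<Sum>j=1..m. f (\<epsilon> ^ j)) + f (\<epsilon> ^ Suc m)"
    by (rule sum.cl_ivl_Suc[THEN trans]) simp
  moreover have "(\<Sum>j<Suc m. f (\<epsilon> ^ j)) = f (\<epsilon> ^ 0) + (\<Sum>j=1..m. f (\<epsilon> ^ j))"
    by (subst sum.lessThan_Suc_shift)
       (simp only: One_nat_def sum.shift_bounds_cl_Suc_ivl sum.atLeast1_atMost_eq)
  ultimately show ?thesis unfolding m by (simp only: add.commute)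
qed

text \<open>After binomial expansion, \<open>k < n\<close> leaves only the term \<open>m = 0\<close>
  in the sum over all roots of unity.\<close>

lemma sum_power_one_minus_roots:
  fixes \<epsilon> :: "'a::field"
  assumes "primitive_root_of_unity n \<epsilon>" "k < n"
  shows "(\<Sum>j<n. (1 - \<epsilon> ^ j) ^ k) = of_nat n"
proof -
  have n: "n > 0" using assms(2) by simp
  have "(1 - z) ^ k = (\<Sum>m\<le>k. of_nat (k choose m) * (-1) ^ m * z ^ m)" for z :: 'a
    using binomial_ring[of "-z" 1 k] by (simp add: power_minus[of z] mult.assoc)
  then have "(\<Sum>j<n. (1 - \<epsilon> ^ j) ^ k) =
      (\<Sum>j<n. \<Sum>m\<le>k. of_nat (k choose m) * (-1) ^ m * (\<epsilon> ^ j) ^ m)" by simp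
  also have "\<dots> = (\<Sum>m\<le>k. of_nat (k choose m) * (-1) ^ m * (\<Sum>j<n. (\<epsilon> ^ j) ^ m))"
    by (subst sum.swap) (simp only: sum_distrib_left)
  also have "\<dots> = (\<Sum>m\<le>k. if m = 0 then of_nat n else 0)"
  proof (rule sum.cong)
    fix m assume "m \<in> {..k}"
    then have "n dvd m \<longleftrightarrow> m = 0" using assms(2) by (auto dest: dvd_imp_le)
    then show "of_nat (k choose m) * (-1) ^ m * (\<Sum>j<n. (\<epsilon> ^ j) ^ m) = (if m = 0 then of_nat n else 0)"
      unfolding primitive_root_sum_powers[OF assms(1) n] by simp
  qed simp
  also have "\<dots> = of_nat n" by simp
  finally show ?thesis .
qed

section \<open>Newton's argument\<close>

text \<open>Dividing by \<open>1 - x j * T\<close> means multiplying by the geometric series with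
  coefficients \<open>x j ^ m\<close>; the induction on \<open>k\<close> carries this out
  coefficientwise.\<close>

lemma coeff_prod_remove_linear_factor:
  fixes x :: "'i \<Rightarrow> 'a::field"
  assumes "finite A" "j \<in> A"
  shows "coeff (\<Prod>i\<in>A - {j}. [:1, - x i:]) k =
    (\<Sum>m\<le>k. x j ^ m * coeff (\<Prod>i\<in>A. [:1, - x i:]) (k - m))"
proof -
  define s where "s = (\<Prod>i\<in>A - {j}. [:1, - x i:])"
  define r where "r = (\<Prod>i\<in>A. [:1, - x i:])"
  have "r = [:1, - x j:] * s"
    unfolding r_def s_def by (rule prod.remove[OF assms])
  then have r: "r = s - pCons 0 (smult (x j) s)" by simp
  have "coeff s k = (\<Sum>m\<le>k. x j ^ m * coeff r (k - m))"
  proof (induction k)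
    case 0
    show ?case by (simp add: r)
  next
    case (Suc k)
    have "(\<Sum>m\<le>Suc k. x j ^ m * coeff r (Suc k - m)) =
        coeff r (Suc k) + x j * (\<Sum>m\<le>k. x j ^ m * coeff r (k - m))"
      by (subst sum.atMost_Suc_shift) (simp add: sum_distrib_left mult.assoc)
    also have "\<dots> = coeff r (Suc k) + x j * coeff s k" by (simp only: Suc.IH)
    also have "\<dots> = coeff s (Suc k)" by (simp add: r)
    finally show ?case by simp
  qed
  then show ?thesis unfolding s_def r_def .
qed

text \<open>This is the logarithmic derivative of \<open>r\<close>, that is, \<open>r' / r\<close>
  equals minus the sum of the \<open>x j / (1 - x j * T)\<close>, compared at \<open>T ^ k\<close>.
  The coefficients of \<open>r\<close> are the signed elementary symmetric functions of the
  \<open>x j\<close>.\<close>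

lemma Newton_identity:
  fixes x :: "'i \<Rightarrow> 'a::field"
  assumes "finite A"
  defines "r \<equiv> \<Prod>i\<in>A. [:1, - x i:]"
  shows "of_nat (Suc k) * coeff r (Suc k) = - (\<Sum>m\<le>k. (\<Sum>j\<in>A. x j ^ Suc m) * coeff r (k - m))"
proof -
  have pd: "pderiv [:1, - x j:] = [:- x j:]" for j by (simp add: pderiv_pCons)
  have "of_nat (Suc k) * coeff r (Suc k) = coeff (pderiv r) k" by (simp only: coeff_pderiv)
  also have "\<dots> = (\<Sum>j\<in>A. coeff (\<Prod>i\<in>A - {j}. [:1, - x i:]) k * - x j)"
    unfolding r_def pderiv_prod pd by (simp add: coeff_sum mult.commute)
  also have "\<dots> = - (\<Sum>j\<in>A. \<Sum>m\<le>k. x j ^ Suc m * coeff r (k - m))"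
    by (simp add: coeff_prod_remove_linear_factor[OF assms(1)] r_def sum_distrib_left
        sum_negf mult_ac)
  also have "\<dots> = - (\<Sum>m\<le>k. (\<Sum>j\<in>A. x j ^ Suc m) * coeff r (k - m))"
    by (subst sum.swap) (simp only: sum_distrib_right)
  finally show ?thesis .
qed

text \<open>Newton's identities give \<open>k * coeff r k = 0\<close> for \<open>k\<close> in
  \<open>{1..n-2}\<close>, and \<open>ch\<close> allows division by \<open>k\<close>. Since
  \<open>r\<close> is the reversal of the product, only the degrees \<open>n\<close>, 1 and 0
  survive there.\<close>

lemma prod_linear_eq_trinomial:
  fixes x :: "'i \<Rightarrow> 'a::field"
  assumes fin: "finite A" and n: "card A = n" "n \<ge> 2"
    and ps: "\<And>k. k \<in> {1..n-2} \<Longrightarrow> (\<Sum>j\<in>A. x j ^ k) = 0"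
    and ch: "\<And>k. k \<in> {1..n-2} \<Longrightarrow> (of_nat k :: 'a) \<noteq> 0"
  obtains a b where "(\<Prod>j\<in>A. [:- x j, 1:]) = monom 1 n + [:b, a:]"
proof -
  define r where "r = (\<Prod>i\<in>A. [:1, - x i:])"
  define f where "f = (\<Prod>j\<in>A. [:- x j, 1:])"
  have r0: "coeff r k = 0" if k: "k \<in> {1..n-2}" for k
  proof -
    obtain l where l: "k = Suc l" using k by (cases k) auto
    have "of_nat k * coeff r k = 0"
      unfolding l r_def Newton_identity[OF fin] neg_equal_0_iff_equal
      
    proof (intro sum.neutral ballI)
      fix m assume "m \<in> {..l}"
      then have "(\<Sum>j\<in>A. x j ^ Suc m) = 0" using k l by (intro ps) auto
      then show "(\<Sum>j\<in>A. x j ^ Suc m) * coeff (\<Prod>i\<in>A. [:1, - x i:]) (l - m) = 0"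
        by (simp only: mult_zero_left)
    qed
    then show ?thesis using ch[OF k] by simp
  qed
  have deg: "degree f = n"
    unfolding f_def using n by (subst degree_prod_eq_sum_degree) auto
  have "lead_coeff f = 1" unfolding f_def by (simp add: lead_coeff_prod)
  then have lead: "coeff f n = 1" by (simp add: deg)
  have "reflect_poly [:- c, 1:] = [:1, - c:]" for c :: 'a
    by (cases "c = 0") (auto simp: reflect_poly_def one_pCons)
  then have refl: "reflect_poly f = r" unfolding f_def r_def by (simp only: reflect_poly_prod)
  have "f = monom 1 n + [:coeff f 0, coeff f 1:]"
  proof (rule poly_eqI)
    fix k
    consider "k = 0" | "k = 1" | "2 \<le> k" "k < n" | "k = n" | "k > n" using n by linarith
    then show "coeff f k = coeff (monom 1 n + [:coeff f 0, coeff f 1:]) k"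
    proof cases
      case 3
      \<comment> \<open>Reversal sends the middle degrees \<open>2 \<le> k < n\<close> to
        \<open>n - k\<close> in \<open>{1..n-2}\<close>, exactly the range of
        \<open>r0\<close>.\<close>
      then have "coeff r (n - k) = 0" by (intro r0) auto
      moreover have "n - (n - k) = k" "\<not> n < n - k" using 3 by auto
      ultimately have "coeff f k = 0"
        using coeff_reflect_poly[of f "n - k", unfolded refl deg] by simp
      with 3 show ?thesis by (auto simp: coeff_pCons split: nat.splits)
    next
      case 5
      then have "coeff f k = 0" using deg by (simp add: coeff_eq_0)
      with 5 n show ?thesis by (auto simp: coeff_pCons split: nat.splits)
    qed (use n lead in \<open>auto simp: coeff_pCons split: nat.splits\<close>)
  qed
  then show thesis using that unfolding f_def by blast
qed

section \<open>Points with two equal coordinates\<close>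

text \<open>The derivative of \<open>T ^ (p - 1) + a * T + b\<close> vanishes at the double root
  \<open>c\<close>; as \<open>p - 1\<close> is -1 in the field, \<open>a = c ^ (p - 2)\<close>, and
  then \<open>b\<close> follows from \<open>c\<close> being a root. The homogeneous form also covers
  \<open>c = 0\<close>, which is only excluded later.\<close>

lemma coords_with_double_root:
  fixes x :: "'i \<Rightarrow> 'a::field"
  assumes p: "prime p" "p \<ge> 3" "CHAR('a) = p" and A: "finite A" "card A = p - 1"
    and ps: "\<And>k. k \<in> {1..p-3} \<Longrightarrow> (\<Sum>j\<in>A. x j ^ k) = 0"
    and uv: "u \<in> A" "v \<in> A" "u \<noteq> v" "x u = c" "x v = c"
    and j: "j \<in> A"
  shows "x j ^ (p - 1) + c ^ (p - 2) * x j = 2 * c ^ (p - 1)"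
proof -
  define f where "f = (\<Prod>j\<in>A. [:- x j, 1:])"
  have ch: "(of_nat k :: 'a) \<noteq> 0" if "k \<in> {1..p-1-2}" for k
    using that p by (auto simp: of_nat_eq_0_iff_char_dvd dest: dvd_imp_le)
  have "p - 1 - 2 = p - 3" by simp
  then have ps': "(\<Sum>j\<in>A. x j ^ k) = 0" if "k \<in> {1..p-1-2}" for k
    using ps that by metis
  obtain a b where f: "f = monom 1 (p - 1) + [:b, a:]"
    unfolding f_def by (rule prod_linear_eq_trinomial[OF A _ ps' ch]) (use p in auto)
  have evalf: "poly f z = z ^ (p - 1) + a * z + b" for z
    by (simp add: f poly_monom algebra_simps)
  have root: "poly f (x i) = 0" if "i \<in> A" for i
    using that A unfolding f_def poly_prod by (auto intro!: prod_zero)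
  have "f = [:- x u, 1:] * (\<Prod>j\<in>A - {u}. [:- x j, 1:])"
    unfolding f_def using A uv by (intro prod.remove)
  also have "(\<Prod>j\<in>A - {u}. [:- x j, 1:]) = [:- x v, 1:] * (\<Prod>j\<in>A - {u} - {v}. [:- x j, 1:])"
    using A uv by (intro prod.remove) auto
  finally have ff: "f = [:- c, 1:] * ([:- c, 1:] * (\<Prod>j\<in>A - {u} - {v}. [:- x j, 1:]))"
    unfolding uv .
  have "poly (pderiv f) c = 0"
    unfolding ff by (simp only: pderiv_mult poly_add poly_mult) simp
  moreover have "(of_nat (p - 1) :: 'a) = -1"
    using p of_nat_CHAR[where 'a = 'a] by (simp add: of_nat_diff)
  ultimately have a: "a = c ^ (p - 2)"
    using p by (simp add: f pderiv_add pderiv_monom pderiv_pCons poly_monom numeral_2_eq_2)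
  have "p - 1 = Suc (p - 2)" using p by simp
  then have c: "c ^ (p - 1) = c ^ (p - 2) * c" by simp
  have "c ^ (p - 1) + a * c + b = 0" using root[OF uv(1)] uv(4) evalf by simp
  then have b: "b = - 2 * c ^ (p - 1)" unfolding a c by (simp add: eq_neg_iff_add_eq_0 algebra_simps)
  show ?thesis using root[OF j] unfolding evalf a b by (simp add: algebra_simps)
qed

text \<open>Frobenius gives \<open>(1 - z) ^ p = 1 - z ^ p\<close>, and the trinomial turns the
  right side into \<open>(1 - z)\<^sup>2\<close>, which can be cancelled as
  \<open>z \<noteq> 1\<close>.\<close>

lemma root_of_double_root_trinomial:
  fixes z :: "'a::field"
  assumes p: "prime p" "p \<ge> 3" "CHAR('a) = p" and z: "z ^ (p - 1) + z = 2" "z \<noteq> 1"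
  shows "(1 - z) ^ (p - 2) = 1"
proof -
  have split: "y ^ p = y ^ (p - 2) * y\<^sup>2" "y ^ p = y ^ (p - 1) * y" for y :: 'a
  proof -
    have "p = (p - 2) + 2" "p = Suc (p - 1)" using p by simp_all
    then show "y ^ p = y ^ (p - 2) * y\<^sup>2" "y ^ p = y ^ (p - 1) * y"
      by (metis power_add, metis power_Suc2)
  qed
  have "1 ^ p = ((1 - z) + z) ^ p" by simp
  also have "\<dots> = (1 - z) ^ p + z ^ p"
    by (rule freshmans_dream'[where n = 1]) (use p in simp_all)
  finally have "(1 - z) ^ p = 1 - z ^ p" by (simp add: algebra_simps)
  also have "z ^ p = (2 - z) * z"
    unfolding split(2) using z(1) by (simp add: eq_diff_eq)
  also have "1 - (2 - z) * z = (1 - z)\<^sup>2" by (simp add: power2_eq_square algebra_simps)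
  finally show ?thesis using z(2) unfolding split(1) by simp
qed

section \<open>Coordinates of projective points\<close>

lemma proj_point_scale:
  assumes "c \<noteq> (0 :: 'a::field)"
  shows "proj_point (\<lambda>j. c * x j) = proj_point x"
proof -
  have "(\<lambda>j. e * x j) \<in> proj_point (\<lambda>j. c * x j)" if "e \<noteq> 0" for e
    unfolding proj_point_def using that assms
    by (auto intro!: exI[of _ "e / c"] simp: fun_eq_iff)
  then show ?thesis
    using assms unfolding proj_point_def by (force simp: mult.assoc[symmetric])
qed

lemma proj_point_self: "x \<in> proj_point x"
  unfolding proj_point_def by (auto intro!: exI[of _ 1])

text \<open>Quotients of coordinates do not change under scaling, so \<open>x b = x b / x a\<close>
  is a quotient of two elements fixed by \<open>z \<mapsto> z ^ q\<close>. Normalising one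
  coordinate to 1 thus makes rationality of a point testable on its coordinates.\<close>

lemma PG_fixed_coord:
  fixes x :: "nat \<Rightarrow> 'a::field"
  assumes "proj_point x \<in> PG m {z. z ^ q = z}" "x a = 1" "a \<in> {1..m+1}" "b \<in> {1..m+1}"
  shows "x b ^ q = x b"
proof -
  obtain y where y: "proj_point x = proj_point y" "\<And>j. j \<in> {1..m+1} \<Longrightarrow> y j ^ q = y j"
    using assms(1) unfolding PG_def by auto
  obtain c where c: "x = (\<lambda>j. c * y j)"
    using proj_point_self[of x] unfolding y(1) by (auto simp: proj_point_def)
  then have c0: "c \<noteq> 0" using assms(2) by auto
  have "y a = 1 / c" using assms(2) c0 unfolding c by (simp add: eq_divide_eq mult.commute)
  then have "x b = y b / y a" unfolding c by simp
  then show ?thesis using y(2) assms(3,4) by (simp add: power_divide)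
qed

lemma proj_point_in_PG:
  assumes "\<And>j. j \<in> {1..m+1} \<Longrightarrow> x j \<in> F" "\<And>j. j \<notin> {1..m+1} \<Longrightarrow> x j = 0" "x a \<noteq> 0"
  shows "proj_point x \<in> PG m F"
  using assms unfolding PG_def by blast

lemma proj_point_in_curve_V:
  fixes x :: "nat \<Rightarrow> 'a::field"
  assumes "p \<ge> 2" "\<And>j. j \<notin> {1..p-1} \<Longrightarrow> x j = 0" "x a \<noteq> 0"
    and "\<And>k. k \<in> {1..p-3} \<Longrightarrow> (\<Sum>j=1..p-1. x j ^ k) = 0"
  shows "proj_point x \<in> curve_V p"
proof -
  have "p - 2 + 1 = p - 1" using assms(1) by simp
  then have "proj_point x \<in> PG (p - 2) UNIV"
    by (intro proj_point_in_PG[of _ _ _ a]) (use assms in auto)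
  moreover have "(\<Sum>j=1..p-1. (c * x j) ^ k) = 0" if "k \<in> {1..p-3}" for c k
    using assms(4)[OF that] by (simp add: power_mult_distrib sum_distrib_left[symmetric])
  ultimately show ?thesis unfolding curve_V_def by (auto simp: proj_point_def)
qed

lemma permute_coords_proj_point:
  "permute_coords \<pi> (proj_point x) = proj_point (x \<circ> Hilbert_Choice.inv \<pi>)"
  unfolding permute_coords_def proj_point_def by (auto simp: o_def fun_eq_iff image_iff)

section \<open>The two orbits\<close>

lemma Omega_theta_subset:
  fixes p d :: nat
  assumes p: "prime p" "p \<ge> 7" "CHAR('a::alg_closed_field) = p"
    and d: "d > 0" "(p - 2) dvd (p ^ d - 1)"
  shows "(Omega_theta p :: 'a point set) \<subseteq> V_points p d"
proof
  fix P :: "'a point" assume P: "P \<in> Omega_theta p"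
  have two: "(2 :: 'a) \<noteq> 0"
    using p of_nat_eq_0_iff_char_dvd[where 'a = 'a, of 2] by (auto dest: dvd_imp_le)
  have p5: "p \<ge> 5" using p by simp
  obtain u v where uv: "P \<in> curve_V p" "u \<in> {1..p-1}" "v \<in> {1..p-1}" "u \<noteq> v" "\<forall>x\<in>P. x u = x v"
    using P unfolding Omega_theta_iff[OF p5 two] by blast
  have p1: "p - 2 + 1 = p - 1" using p by simp
  obtain x w where x: "P = proj_point x" "\<And>j. j \<notin> {1..p-1} \<Longrightarrow> x j = 0" "x w \<noteq> 0"
    using uv(1) unfolding curve_V_def PG_def p1 by auto
  have xP: "x \<in> P" unfolding x(1) by (rule proj_point_self)
  have ps: "(\<Sum>j=1..p-1. x j ^ k) = 0" if "k \<in> {1..p-3}" for k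
    using uv(1) xP that unfolding curve_V_def by auto
  define c where "c = x u"
  have eq: "x j ^ (p - 1) + c ^ (p - 2) * x j = 2 * c ^ (p - 1)" if "j \<in> {1..p-1}" for j
    by (rule coords_with_double_root[where A = "{1..p-1}" and u = u and v = v])
       (use p uv xP ps that in \<open>auto simp: c_def\<close>)
  \<comment> \<open>With \<open>c = 0\<close> the equation \<open>eq\<close> becomes
    \<open>x j ^ (p - 1) = 0\<close>, so all homogeneous coordinates would vanish.\<close>
  have c0: "c \<noteq> 0"
  proof
    assume "c = 0"
    moreover have "w \<in> {1..p-1}" using x by blast
    ultimately have "x w ^ (p - 1) = 0" using eq[of w] p by (simp add: power_0_left)
    then show False using x(3) by simp
  qed
  define y where "y = (\<lambda>j. inverse c * x j)"
  have Py: "P = proj_point y" unfolding x(1) y_def using c0 by (simp add: proj_point_scale)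
  have "y j ^ (p ^ d) = y j" if "j \<in> {1..p-1}" for j
  proof (cases "y j = 1")
    case False
    have "p - 1 = Suc (p - 2)" using p by simp
    then have cp: "c ^ (p - 1) = c ^ (p - 2) * c" by (simp only: power_Suc2)
    have xj: "x j = c * y j" using c0 by (simp add: y_def)
    \<comment> \<open>By homogeneity, dividing \<open>eq\<close> by \<open>c ^ (p - 1)\<close>
      yields the trinomial with double root 1.\<close>
    have "c ^ (p - 1) * (y j ^ (p - 1) + y j) = x j ^ (p - 1) + c ^ (p - 2) * x j"
      by (simp only: distrib_left xj power_mult_distrib cp mult.assoc)
    also have "\<dots> = c ^ (p - 1) * 2"
      using eq[OF that] by (simp only: mult.commute)
    finally have "c ^ (p - 1) * (y j ^ (p - 1) + y j) = c ^ (p - 1) * 2" .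
    then have "y j ^ (p - 1) + y j = 2" using c0 by simp
    then have "(1 - y j) ^ (p - 2) = 1"
      using p False by (intro root_of_double_root_trinomial) auto
    then have "(1 - y j) ^ (p ^ d - 1) = 1"
      using d(2) by (auto simp: power_mult)
    moreover have "p ^ d = Suc (p ^ d - 1)" using p by simp
    ultimately have "(1 - y j) ^ (p ^ d) = 1 - y j" by (metis mult_1_right power_Suc)
    \<comment> \<open>Additivity of the Frobenius power carries fixedness from
      \<open>1 - y j\<close> over to \<open>y j\<close>.\<close>
    moreover have "((1 - y j) + y j) ^ (p ^ d) = (1 - y j) ^ (p ^ d) + y j ^ (p ^ d)"
      by (rule freshmans_dream'[where n = d]) (use p in simp_all)
    ultimately show ?thesis by simp
  qed simp
  then have "P \<in> PG (p - 2) (GF (p ^ d))"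
    unfolding Py GF_eq(1)[OF p(1,3) d(1)]
    by (intro proj_point_in_PG[of _ _ _ u]) (use c0 x(2) p1 in \<open>auto simp: y_def c_def\<close>)
  then show "P \<in> V_points p d" using uv(1) unfolding V_points_def by blast
qed

lemma Omega_eps_subset:
  fixes p d :: nat and \<epsilon> :: "'a::alg_closed_field"
  assumes p: "prime p" "p \<ge> 7" "CHAR('a) = p"
    and eps: "primitive_root_of_unity (p - 2) \<epsilon>"
    and d: "d > 0" "(p - 2) dvd (p ^ d - 1)"
  shows "Omega_eps p \<epsilon> \<subseteq> V_points p d"
proof
  fix P assume "P \<in> Omega_eps p \<epsilon>"
  then obtain \<pi> where \<pi>: "\<pi> permutes {1..p-1}" "P = permute_coords \<pi> (eps_point p \<epsilon>)"
    unfolding Omega_eps_def orbit_def by (auto simp: sym_group_carrier)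
  define e where "e = (\<lambda>j. if j \<in> {1..p-2} then \<epsilon> ^ j else 0)"
  define x where "x = e \<circ> Hilbert_Choice.inv \<pi>"
  have P: "P = proj_point x"
    unfolding \<pi>(2) x_def e_def eps_point_def by (rule permute_coords_proj_point)
  have inv: "Hilbert_Choice.inv \<pi> permutes {1..p-1}" using \<pi>(1) by (rule permutes_inv)
  have x0: "x j = 0" if "j \<notin> {1..p-1}" for j
  proof -
    have "Hilbert_Choice.inv \<pi> j = j" using inv that by (simp add: permutes_not_in)
    then show ?thesis using that by (auto simp: x_def e_def)
  qed
  have "\<epsilon> \<noteq> 0"
    using p by (intro primitive_root_nonzero[OF eps]) simp
  then have "e 1 \<noteq> 0" using p by (simp add: e_def)
  \<comment> \<open>Coordinate 1 of \<open>e\<close>, which is \<open>\<epsilon>\<close>, is moved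
    to position \<open>\<pi> 1\<close>; this serves as the nonzero coordinate of the point.\<close>
  then have x1: "x (\<pi> 1) \<noteq> 0" using permutes_inverses(2)[OF \<pi>(1)] by (simp add: x_def)
  have ps: "(\<Sum>j=1..p-1. x j ^ k) = 0" if k: "k \<in> {1..p-3}" for k
  proof -
    have "(\<Sum>j=1..p-1. x j ^ k) = (\<Sum>j=1..p-1. e j ^ k)"
      using sum.permute[OF inv, of "\<lambda>j. e j ^ k"] by (simp add: x_def o_def)
    also have "\<dots> = (\<Sum>j=1..p-2. (\<epsilon> ^ j) ^ k)"
      by (rule sum.mono_neutral_cong_right) (use k in \<open>auto simp: e_def\<close>)
    also have "\<dots> = (\<Sum>j<p-2. (\<epsilon> ^ j) ^ k)"
      using p by (intro sum_primitive_root_shift[OF eps]) simp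
    also have "\<dots> = 0"
      \<comment> \<open>Here \<open>0 < k < p - 2\<close>, so \<open>p - 2\<close> does not divide
        \<open>k\<close>.\<close>
      using p k by (subst primitive_root_sum_powers[OF eps]) (auto dest: dvd_imp_le)
    finally show ?thesis .
  qed
  have "\<epsilon> ^ (p ^ d - 1) = 1"
    using p d(2) by (simp add: primitive_root_power_eq_1_iff[OF eps])
  moreover have pd: "p ^ d = Suc (p ^ d - 1)" using p by simp
  ultimately have "\<epsilon> ^ (p ^ d) = \<epsilon>" by (metis mult_1_right power_Suc)
  then have "(\<epsilon> ^ j) ^ (p ^ d) = \<epsilon> ^ j" for j by (metis mult.commute power_mult)
  then have "x j ^ (p ^ d) = x j" for j using p by (simp add: x_def e_def)
  then have "P \<in> PG (p - 2) (GF (p ^ d))"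
    unfolding P GF_eq(1)[OF p(1,3) d(1)]
    by (intro proj_point_in_PG[of _ _ _ "\<pi> 1"]) (use x0 x1 p in auto)
  moreover have "P \<in> curve_V p"
    unfolding P by (rule proj_point_in_curve_V[OF _ x0 x1 ps]) (use p in auto)
  ultimately show "P \<in> V_points p d" unfolding V_points_def by blast
qed

section \<open>Rationality of either orbit forces \<open>\<epsilon>\<close> into the field\<close>

lemma Omega_eps_subset_imp_fixed:
  fixes p i :: nat and \<epsilon> :: "'a::alg_closed_field"
  assumes p: "prime p" "p \<ge> 7" "CHAR('a) = p"
    and eps: "primitive_root_of_unity (p - 2) \<epsilon>"
    and i: "i > 0" "Omega_eps p \<epsilon> \<subseteq> V_points p i"
  shows "\<epsilon> ^ (p ^ i) = \<epsilon>"
proof -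
  define e where "e = (\<lambda>j. if j \<in> {1..p-2} then \<epsilon> ^ j else 0)"
  have "id \<in> carrier (sym_group (p - 1))" by (simp add: sym_group_carrier permutes_id)
  moreover have "permute_coords id (proj_point e) = proj_point e"
    by (simp add: permute_coords_proj_point)
  ultimately have "proj_point e \<in> Omega_eps p \<epsilon>"
    unfolding Omega_eps_def orbit_def eps_point_def e_def[symmetric] by force
  then have "proj_point e \<in> PG (p - 2) {z. z ^ (p ^ i) = z}"
    using i unfolding V_points_def GF_eq(1)[OF p(1,3) i(1)] by blast
  \<comment> \<open>The base point already has a coordinate 1, so its first coordinate
    \<open>\<epsilon>\<close> must itself be fixed.\<close>
  moreover have "e (p - 2) = 1" using eps p by (simp add: e_def primitive_root_of_unity_def)
  ultimately have "e 1 ^ (p ^ i) = e 1" by (rule PG_fixed_coord) (use p in auto)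
  moreover have "e 1 = \<epsilon>" using p by (simp add: e_def)
  ultimately show ?thesis by simp
qed

lemma Omega_theta_subset_imp_fixed:
  fixes p i :: nat and \<epsilon> :: "'a::alg_closed_field"
  assumes p: "prime p" "p \<ge> 7" "CHAR('a) = p"
    and eps: "primitive_root_of_unity (p - 2) \<epsilon>"
    and i: "i > 0" "(Omega_theta p :: 'a point set) \<subseteq> V_points p i"
  shows "\<epsilon> ^ (p ^ i) = \<epsilon>"
proof -
  \<comment> \<open>These are the roots of \<open>T ^ (p - 1) + T - 2\<close> with multiplicity: the
    double root 1 takes the last two places.\<close>
  define x where "x = (\<lambda>j. if j \<in> {1..p-3} then 1 - \<epsilon> ^ j else if j \<in> {p-2, p-1} then 1 else 0)"
  have two: "(2 :: 'a) \<noteq> 0"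
    using p of_nat_eq_0_iff_char_dvd[where 'a = 'a, of 2] by (auto dest: dvd_imp_le)
  have x0: "x j = 0" if "j \<notin> {1..p-1}" for j using that p by (auto simp: x_def)
  have x1: "x (p - 1) = 1" "x (p - 2) = 1" using p by (auto simp: x_def)
  have ps: "(\<Sum>j=1..p-1. x j ^ k) = 0" if k: "k \<in> {1..p-3}" for k
  proof -
    have "{1..p-1} = {1..p-3} \<union> {p-2, p-1}" using p by auto
    moreover have "{1..p-3} \<inter> {p-2, p-1} = {}" "p - 2 \<noteq> p - 1" using p by auto
    ultimately have "(\<Sum>j=1..p-1. x j ^ k) = (\<Sum>j=1..p-3. x j ^ k) + 2"
      by (simp add: sum.union_disjoint x1[simplified])
    also have "(\<Sum>j=1..p-3. x j ^ k) = (\<Sum>j=1..p-3. (1 - \<epsilon> ^ j) ^ k)"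
      by (rule sum.cong) (auto simp: x_def)
    \<comment> \<open>The added index \<open>j = 0\<close> contributes \<open>0 ^ k\<close>, which
      is 0 because \<open>k \<ge> 1\<close>.\<close>
    also have "\<dots> = (\<Sum>j<p-2. (1 - \<epsilon> ^ j) ^ k)"
    proof (rule sum.mono_neutral_left)
      show "\<forall>j\<in>{..<p - 2} - {1..p - 3}. (1 - \<epsilon> ^ j) ^ k = 0"
      proof
        fix j assume "j \<in> {..<p - 2} - {1..p - 3}"
        then have "j = 0" by auto
        then show "(1 - \<epsilon> ^ j) ^ k = 0" using k by simp
      qed
    qed (use p in auto)
    also have "\<dots> = of_nat (p - 2)"
      using k p by (intro sum_power_one_minus_roots[OF eps]) auto
    \<comment> \<open>As \<open>p\<close> is 0 in the field, this cancels the 2 contributed by the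
      two coordinates equal to 1.\<close>
    also have "\<dots> = - 2"
      using p of_nat_CHAR[where 'a = 'a] by (simp add: of_nat_diff)
    finally show ?thesis by simp
  qed
  have V: "proj_point x \<in> curve_V p"
    by (rule proj_point_in_curve_V[OF _ x0 _ ps, of "p - 1"]) (use p x1 in auto)
  have "\<forall>y\<in>proj_point x. y (p - 2) = y (p - 1)" by (auto simp: proj_point_def x1[simplified])
  moreover have "p - 2 \<in> {1..p-1}" "p - 1 \<in> {1..p-1}" "p - 2 \<noteq> p - 1" "p \<ge> 5" using p by auto
  ultimately have "proj_point x \<in> Omega_theta p"
    unfolding Omega_theta_iff[OF \<open>p \<ge> 5\<close> two] using V by blast
  then have "proj_point x \<in> PG (p - 2) {z. z ^ (p ^ i) = z}"
    using i unfolding V_points_def GF_eq(1)[OF p(1,3) i(1)] by blast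
  then have "x 1 ^ (p ^ i) = x 1" using x1(1) by (rule PG_fixed_coord) (use p in auto)
  moreover have "x 1 = 1 - \<epsilon>" using p by (simp add: x_def)
  ultimately have "(1 - \<epsilon>) ^ (p ^ i) = 1 - \<epsilon>" by simp
  moreover have "((1 - \<epsilon>) + \<epsilon>) ^ (p ^ i) = (1 - \<epsilon>) ^ (p ^ i) + \<epsilon> ^ (p ^ i)"
    by (rule freshmans_dream'[where n = i]) (use p in simp_all)
  ultimately show ?thesis by simp
qed

lemma primitive_root_Frobenius_fixed_imp_dvd:
  fixes \<epsilon> :: "'a::field"
  assumes "primitive_root_of_unity n \<epsilon>" "n > 0" "\<epsilon> ^ q = \<epsilon>" "q > 0"
  shows "n dvd q - 1"
proof -
  have "\<epsilon> \<noteq> 0" using assms(1,2) by (rule primitive_root_nonzero)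
  moreover have "\<epsilon> * \<epsilon> ^ (q - 1) = \<epsilon>" using assms(3,4) by (metis Suc_diff_1 power_Suc)
  ultimately show ?thesis by (simp add: primitive_root_power_eq_1_iff[OF assms(1,2), symmetric])
qed

theorem theorem8p8:
  fixes p d :: nat and \<epsilon> :: "'p::prime_card fp_bar"
  assumes "prime p" and "p \<ge> 7" and "p = CARD('p)"
    and "primitive_root_of_unity (p - 2) \<epsilon>"
    and "d = (LEAST d. 0 < d \<and> (p - 2) dvd (p ^ d - 1))"
  shows "(Omega_theta p :: 'p fp_bar point set) \<subseteq> V_points p d \<and>
    Omega_eps p \<epsilon> \<subseteq> V_points p d \<and>
    (\<forall>i. 0 < i \<and> i < d \<longrightarrow>
      \<not> (Omega_theta p :: 'p fp_bar point set) \<subseteq> V_points p i \<and>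
      \<not> Omega_eps p \<epsilon> \<subseteq> V_points p i)"
proof -
  have p: "prime p" "p \<ge> 7" "CHAR('p fp_bar) = p" using assms(1-3) by simp_all
  \<comment> \<open>Euler's theorem then supplies a positive exponent with the required
    divisibility, so the \<open>LEAST\<close> defining \<open>d\<close> is attained.\<close>
  have "coprime p (p - 2)"
  proof -
    have "\<not> p dvd p - 2" using p(2) by (auto dest: dvd_imp_le)
    then show ?thesis using p(1) by (simp add: prime_imp_coprime)
  qed
  then have "[p ^ totient (p - 2) = 1] (mod (p - 2))" by (rule euler_theorem)
  then have "(p - 2) dvd (p ^ totient (p - 2) - 1)"
    by (rule cong_to_1_nat)
  then have "\<exists>d. 0 < d \<and> (p - 2) dvd (p ^ d - 1)"
    using p(2) by (intro exI[of _ "totient (p - 2)"]) simp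
  then have d: "0 < d" "(p - 2) dvd (p ^ d - 1)"
    unfolding assms(5) by (metis (mono_tags, lifting) LeastI_ex)+
  \<comment> \<open>A fixed \<open>\<epsilon>\<close> would make \<open>p - 2\<close> divide
    \<open>p ^ i - 1\<close>, against the minimality of \<open>d\<close>.\<close>
  have "\<epsilon> ^ (p ^ i) \<noteq> \<epsilon>" if "0 < i" "i < d" for i
  proof
    assume "\<epsilon> ^ (p ^ i) = \<epsilon>"
    then have "(p - 2) dvd (p ^ i - 1)"
      using p by (intro primitive_root_Frobenius_fixed_imp_dvd[OF assms(4)]) auto
    then show False using that not_less_Least unfolding assms(5) by blast
  qed
  then show ?thesis
    using Omega_theta_subset[OF p d] Omega_eps_subset[OF p assms(4) d]
      Omega_theta_subset_imp_fixed[OF p assms(4)] Omega_eps_subset_imp_fixed[OF p assms(4)] by blast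
qed

end
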